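(* Let $m\geq 3$ and $k$ be integers, and if $m$ is even assume that $k\neq 1$. Then the recursion $$x_{n+1}=x_n^m-k,\qquad n\ge 0,$$ has no nontrivial integral periodic orbits; that is, every sequence of integers $(x_n)_{n\geq 0}$ that satisfies this recursion and is periodic is constant.
   Context: A sequence $(x_n)_{n\ge 0}$ is periodic if there is a positive integer $p$ with $x_{n+p}=x_n$ for all $n\ge 0$. A trivial orbit is a constant solution $x_n=r$, i.e. a fixed point $r$ of $f(x)=x^m-k$. An integral orbit is one all of whose terms lie in $\mathbb{Z}$. *)

theory Defs
  imports Main
begin

definition periodic_seq :: "(nat \<Rightarrow> 'a) \<Rightarrow> bool" where
  "periodic_seq x \<longleftrightarrow> (\<exists>p>0. \<forall>n. x (n + p) = x n)"

end

theory Submission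
  imports Defs
begin

text \<open>
  For odd \<open>m\<close> the map \<open>f z = z ^ m - k\<close> is increasing, so an orbit is monotone, and a monotone
  periodic sequence is constant. For even \<open>m\<close>, each difference \<open>d\<^sub>n = x\<^sub>n\<^sub>+\<^sub>1 - x\<^sub>n\<close> divides the
  next one; by periodicity all of them have the same absolute value. Unless the orbit is monotone
  two consecutive differences cancel, which gives a 2-cycle \<open>{a, b}\<close> of \<open>f\<close>. An estimate of
  \<open>a ^ m - b ^ m = b - a\<close> leaves only the cycle \<open>{-1, 0}\<close>, and this forces \<open>k = 1\<close>.
\<close>

text \<open>Shifting \<open>j\<close> by whole periods keeps the value \<open>f j\<close> and
  carries the index past \<open>i\<close>, where a chain of \<open>R\<close>-steps from
  \<open>i\<close> arrives. \<open>R\<close> is only a preorder, so that divisibility of integers is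
  covered along with both orders.\<close>

lemma periodic_seq_related:
  assumes "periodic_seq f" "reflp R" "transp R" "\<And>n. R (f n) (f (Suc n))"
  shows "R (f i) (f j)"
proof -
  obtain p where p: "p > 0" "\<And>n. f (n + p) = f n"
    using assms(1) unfolding periodic_seq_def by auto
  have mult: "f (n + q * p) = f n" for n q
  proof (induction q)
    case (Suc q)
    then show ?case using p(2)[of "n + q * p"] by (simp add: algebra_simps)
  qed simp
  have mono: "R (f n) (f (n + l))" for n l
  proof (induction l)
    case 0
    show ?case using assms(2) by (simp add: reflpD)
  next
    case (Suc l)
    then show ?case using transpD[OF assms(3) _ assms(4)] by simp
  qed
  have "i \<le> j + i * p" using p(1) by (cases p) auto
  then show ?thesis using mono[of i "j + i * p - i"] mult[of j i] by simp
qed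

lemma periodic_incseq_const:
  fixes f :: "nat \<Rightarrow> 'a::order"
  assumes "periodic_seq f" "\<And>n. f n \<le> f (Suc n)"
  shows "f i = f j"
  using periodic_seq_related[of f "(\<le>)"] assms by (simp add: antisym)

lemma periodic_decseq_const:
  fixes f :: "nat \<Rightarrow> 'a::order"
  assumes "periodic_seq f" "\<And>n. f (Suc n) \<le> f n"
  shows "f i = f j"
  using periodic_seq_related[of f "(\<ge>)"] assms by (simp add: antisym)

lemma periodic_orbit_of_mono_const:
  fixes x :: "nat \<Rightarrow> 'a::linorder"
  assumes "periodic_seq x" "mono f" "\<And>n. x (Suc n) = f (x n)"
  shows "x i = x j"
proof (cases "x 0 \<le> x 1")
  case True
  have "x n \<le> x (Suc n)" for n
  proof (induction n)
    case (Suc n)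
    then show ?case using monoD[OF assms(2)] assms(3) by metis
  qed (use True in simp)
  then show ?thesis using periodic_incseq_const assms(1) by blast
next
  case False
  have "x (Suc n) \<le> x n" for n
  proof (induction n)
    case (Suc n)
    then show ?case using monoD[OF assms(2)] assms(3) by metis
  qed (use False in simp)
  then show ?thesis using periodic_decseq_const assms(1) by blast
qed

lemma even_power_two_cycle:
  fixes a b k :: int
  assumes "even m" "m \<ge> 3" "b = a ^ m - k" "a = b ^ m - k" "a < b"
  shows "k = 1"
proof -
  define c e where "c = \<bar>a\<bar>" and "e = \<bar>b\<bar>"
  obtain l where l: "m = l + 2" "l > 0"
    using assms(2) that[of "m - 2"] by simp
  have diff: "c ^ m - e ^ m = b - a"
    using assms(3,4) power_even_abs[OF assms(1), of a] power_even_abs[OF assms(1), of b]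
    unfolding c_def e_def by linarith
  have less: "e < c"
  proof (rule ccontr)
    assume "\<not> e < c"
    then have "c ^ m \<le> e ^ m" by (simp add: power_mono c_def)
    with diff assms(5) show False by simp
  qed
  have e0: "e \<ge> 0" by (simp add: e_def)
  \<comment> \<open>Bound the difference of powers below by a multiple of \<open>c + e\<close> and
    above by \<open>c + e\<close> itself; cancelling this positive factor leaves
    \<open>c ^ l * (c - e) \<le> 1\<close>.\<close>
  have "c ^ l * ((c + e) * (c - e)) = c ^ m - c ^ l * e ^ 2"
    by (simp add: l(1) algebra_simps power_add power2_eq_square)
  also have "\<dots> \<le> c ^ m - e ^ l * e ^ 2"
    using less e0 by (simp add: mult_right_mono power_mono)
  also have "\<dots> = b - a" using diff by (simp only: l(1) power_add)
  also have "\<dots> \<le> c + e" by (simp add: c_def e_def)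
  finally have "(c + e) * (c ^ l * (c - e)) \<le> (c + e) * 1"
    by (simp add: algebra_simps)
  then have "c ^ l * (c - e) \<le> 1"
    using less e0 by (subst (asm) mult_le_cancel_left_pos) auto
  moreover have "c ^ l * 1 \<le> c ^ l * (c - e)"
    using less e0 by (intro mult_left_mono) auto
  ultimately have "c ^ l \<le> 1" by simp
  \<comment> \<open>Here \<open>m \<ge> 3\<close> enters through \<open>l > 0\<close>: for
    \<open>m = 2\<close> there are further cycles, such as -2, 1 with \<open>k = 3\<close>.\<close>
  moreover have "c \<le> c ^ l" using less e0 l(2) by (intro self_le_power) auto
  ultimately have "c = 1" "e = 0" using less e0 by linarith+
  then have "b = 0" "a = - 1" using assms(5) by (auto simp: c_def e_def)
  then show ?thesis using assms(1,3) by simp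
qed

theorem theorem3:
  fixes m :: nat and k :: int and x :: "nat \<Rightarrow> int"
  assumes "m \<ge> 3"
    and "even m \<Longrightarrow> k \<noteq> 1"
    and "\<forall>n. x (Suc n) = x n ^ m - k"
    and "periodic_seq x"
  shows "\<exists>r. \<forall>n. x n = r"
proof (cases "even m")
  case False
  then have "mono (\<lambda>z::int. z ^ m - k)"
    by (auto intro!: monoI power_mono_odd)
  then have "x n = x 0" for n
    using periodic_orbit_of_mono_const assms(3,4) by blast
  then show ?thesis by blast
next
  case True
  define d where "d n = x (Suc n) - x n" for n
  have per: "periodic_seq d"
    using assms(4) unfolding periodic_seq_def d_def by (metis add_Suc)
  have "d n dvd d (Suc n)" for n
  proof -
    have "d (Suc n) = x (Suc n) ^ m - x n ^ m"
      unfolding d_def using assms(3) by simp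
    \<comment> \<open>The difference \<open>u - v\<close> is a factor of
      \<open>u ^ m - v ^ m\<close>.\<close>
    then show ?thesis
      unfolding d_def by (simp add: power_diff_sumr2)
  qed
  moreover have "reflp ((dvd) :: int \<Rightarrow> int \<Rightarrow> bool)" "transp ((dvd) :: int \<Rightarrow> int \<Rightarrow> bool)"
    by (auto intro!: reflpI transpI intro: dvd_trans)
  ultimately have "d i dvd d j" for i j
    using periodic_seq_related[OF per] by blast
  then have abs_d: "\<bar>d i\<bar> = \<bar>d j\<bar>" for i j
    by (simp add: zdvd_antisym_abs)
  show ?thesis
  proof (cases "\<exists>n. d (Suc n) \<noteq> d n")
    case True
    then obtain n where n: "d (Suc n) \<noteq> d n" by blast
    then have "d (Suc n) = - d n" using abs_d[of "Suc n" n] by linarith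
    then have ret: "x (Suc (Suc n)) = x n" and ne: "x (Suc n) \<noteq> x n"
      using n by (auto simp: d_def)
    have "x (Suc n) = x n ^ m - k" "x n = x (Suc n) ^ m - k"
      using assms(3) ret by metis+
    \<comment> \<open>The two cycle equations are symmetric in the two points, so either may be
      taken as the smaller one.\<close>
    then have "k = 1"
      using even_power_two_cycle \<open>even m\<close> assms(1) ne by (metis linorder_neqE)
    then show ?thesis using assms(2) \<open>even m\<close> by blast
  next
    case False
    \<comment> \<open>Constant differences make the orbit an arithmetic progression, monotone in the
      direction given by the sign of \<open>d 0\<close>.\<close>
    then have const: "d n = d 0" for n by (induction n) auto
    have "x n = x 0" for n
    proof (cases "d 0 \<ge> 0")
      case True
      then have "x n \<le> x (Suc n)" for n using const[of n] by (simp add: d_def)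
      then show ?thesis using periodic_incseq_const assms(4) by blast
    next
      case False
      then have "x (Suc n) \<le> x n" for n using const[of n] by (simp add: d_def)
      then show ?thesis using periodic_decseq_const assms(4) by blast
    qed
    then show ?thesis by blast
  qed
qed

end
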